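(* There is an absolute constant $C$ such that for every positive integer $r$ and every $m$ for which a $\overline{\mathrm{DD}}(m,r)$ exists, \[ m\leq \tfrac{1}{\sqrt{2}}\, r + \tfrac{3}{2^{4/3}}\,r^{2/3}+C\,r^{1/3}. \]
   Context: The square grid is $\mathbb{Z}^2$; the point $(i,j)$ lies in column $i$ and row $j$. The Manhattan distance is $d((i_1,j_1),(i_2,j_2))=|i_2-i_1|+|j_2-j_1|$. A $\overline{\mathrm{DD}}(m,r)$ (square distinct difference configuration) is a set of $m$ points ("dots") of $\mathbb{Z}^2$ such that (1) any two dots are at Manhattan distance at most $r$, and (2) the $\binom{m}{2}$ lines joining pairs of dots are pairwise distinct either in length or in slope; equivalently, the vectors $a-b$, over ordered pairs $(a,b)$ of distinct dots, are pairwise distinct. *)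

theory Defs
  imports Complex_Main "HOL-Library.Product_Plus"
begin

definition manhattan_dist :: "int \<times> int \<Rightarrow> int \<times> int \<Rightarrow> int" where
  "manhattan_dist p q = \<bar>fst q - fst p\<bar> + \<bar>snd q - snd p\<bar>"

definition square_DD :: "nat \<Rightarrow> nat \<Rightarrow> (int \<times> int) set \<Rightarrow> bool" where
  "square_DD m r A \<longleftrightarrow>
     finite A \<and> card A = m \<and>
     (\<forall>p\<in>A. \<forall>q\<in>A. manhattan_dist p q \<le> int r) \<and>
     inj_on (\<lambda>(a, b). a - b) {(a, b). a \<in> A \<and> b \<in> A \<and> a \<noteq> b}"

end

theory Submission
  imports Defs "HOL-Analysis.Convex"
begin

text \<open>
  In the coordinates \<open>i + j\<close>, \<open>i - j\<close> the dots lie in a square with \<open>r + 1\<close> integer positions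
  on each side. Slide a small square window \<open>W\<close> of side \<open>s\<close> over it, as in the Erdos-Turan bound
  for Sidon sets. Since differences of dots are distinct, the windows contain on average few pairs of
  dots, and Cauchy-Schwarz gives \<open>m\<^sup>2 |W| \<le> N (m + |W|)\<close>, where \<open>N\<close> is the number of windows
  that can meet the configuration. Here \<open>|W| \<approx> s\<^sup>2/2\<close> and \<open>N \<approx> (r + s)\<^sup>2/2\<close>; the choice
  \<open>s \<approx> 2\<^bsup>1/6\<^esup> r\<^bsup>2/3\<^esup>\<close> is optimal.
\<close>

section \<open>Double counting dots in translates of a window\<close>

text \<open>Each dot lies in \<open>card W\<close> translates of \<open>W\<close>, so the average
  occupancy is fixed and Cauchy-Schwarz bounds the number of ordered pairs of dots sharing a
  translate from below. Distinctness of differences bounds that number from above.\<close>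

lemma card_distinct_differences_window:
  fixes A W T :: "'a::ab_group_add set"
  assumes fin: "finite A" "finite W" "finite T"
    and inj: "inj_on (\<lambda>(a, b). a - b) {(a, b). a \<in> A \<and> b \<in> A \<and> a \<noteq> b}"
    and T: "\<And>a w. a \<in> A \<Longrightarrow> w \<in> W \<Longrightarrow> a - w \<in> T"
  shows "(card A)\<^sup>2 * card W \<le> card T * (card A + card W)"
proof (cases "W = {}")
  case True
  then show ?thesis by simp
next
  case False
  then have W0: "card W > 0" using fin by (simp add: card_gt_0_iff)
  define f :: "'a \<times> 'a \<Rightarrow> 'a" where "f p = fst p - snd p" for p
  \<comment> \<open>\<open>F t\<close> records the dots in the translate \<open>t + W\<close>, each
    with its position inside the window. \<open>E\<close> collects ordered pairs of such dots,
    counted once per translate.\<close>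
  define F where "F t = {p \<in> A \<times> W. f p = t}" for t
  define E where "E = (SIGMA t:T. F t \<times> F t)"
  have finF: "finite (F t)" for t using fin by (simp add: F_def)
  have f_T: "f ` (A \<times> W) \<subseteq> T" using T by (auto simp: f_def)
  have "(\<Sum>t\<in>T. card (F t)) = card (A \<times> W)"
    using sum.group[of "A \<times> W" T f "\<lambda>_. 1::nat"] fin f_T by (simp add: F_def)
  then have sum_F: "(\<Sum>t\<in>T. real (card (F t))) = real (card A * card W)"
    by (simp add: card_cartesian_product flip: of_nat_sum)
  have card_E: "card E = (\<Sum>t\<in>T. (card (F t))\<^sup>2)"
    unfolding E_def using fin finF
    by (subst card_SigmaI) (auto simp: card_cartesian_product power2_eq_square)
  define D where "D = {(t, p, q) \<in> E. fst p = fst q}"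
  define O' where "O' = {(t, p, q) \<in> E. fst p \<noteq> fst q}"
  have E_split: "E = D \<union> O'" by (auto simp: D_def O'_def)
  have D: "card D \<le> card (A \<times> W)"
  proof (rule card_inj_on_le)
    show "inj_on (\<lambda>(t, p, q). p) D"
      by (auto simp: inj_on_def D_def E_def F_def f_def)
    show "(\<lambda>(t, p, q). p) ` D \<subseteq> A \<times> W"
      by (auto simp: D_def E_def F_def)
  qed (use fin in auto)
  \<comment> \<open>Dots \<open>a\<close> and \<open>b\<close> at window positions \<open>v\<close>
    and \<open>w\<close> satisfy \<open>a - b = v - w\<close>. The positions thus fix the
    difference, hence both dots, hence the translate.\<close>
  have O: "card O' \<le> card (W \<times> W)"
  proof (rule card_inj_on_le)
    show "inj_on (\<lambda>(t, p, q). (snd p, snd q)) O'"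
    proof (rule inj_onI, clarsimp simp: O'_def E_def F_def f_def)
      fix a b c d v w
      assume *: "a \<in> A" "b \<in> A" "a \<noteq> b" "b - w = a - v" "c \<in> A" "d \<in> A" "c \<noteq> d" "d - w = c - v"
      then have "a - b = c - d"
        by (metis diff_eq_eq diff_diff_eq2 add.commute)
      then have "(a, b) = (c, d)" using inj_onD[OF inj, of "(a, b)" "(c, d)"] * by auto
      then show "a = c \<and> b = d" by simp
    qed
    show "(\<lambda>(t, p, q). (snd p, snd q)) ` O' \<subseteq> W \<times> W"
      by (auto simp: O'_def E_def F_def)
  qed (use fin in auto)
  have "card E \<le> card D + card O'"
    unfolding E_split by (rule card_Un_le)
  with D O have E: "card E \<le> card W * (card A + card W)"
    by (simp add: card_cartesian_product algebra_simps)
  have "(real (card A * card W))\<^sup>2 \<le> (\<Sum>t\<in>T. (real (card (F t)))\<^sup>2) * real (card T)"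
    using sum_squared_le_sum_of_squares[of "\<lambda>t. real (card (F t))" T] sum_F by simp
  also have "\<dots> = real (card E * card T)" by (simp add: card_E)
  finally have "(card A * card W)\<^sup>2 \<le> card E * card T"
    by (metis of_nat_le_iff of_nat_power)
  also have "\<dots> \<le> card W * (card A + card W) * card T" using E by simp
  finally have "card W * ((card A)\<^sup>2 * card W) \<le> card W * (card T * (card A + card W))"
    by (simp add: power2_eq_square mult_ac)
  then show ?thesis using W0 by simp
qed

section \<open>Windows and boxes in diagonal coordinates\<close>

text \<open>Since \<open>i + j\<close> and \<open>i - j\<close> have equal parity, a point is
  encoded by \<open>u = i + j\<close> and \<open>c = (i - j) div 2\<close>. The even side
  \<open>2 * k\<close> makes the set a full square in the diagonal coordinates with an exact
  count.\<close>

definition diag_window :: "nat \<Rightarrow> (int \<times> int) set" where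
  "diag_window k = (\<lambda>(u, c). ((u + 1) div 2 + c, u div 2 - c)) ` ({0..<2 * int k} \<times> {0..<int k})"

lemma finite_diag_window: "finite (diag_window k)"
  by (simp add: diag_window_def)

lemma card_diag_window: "card (diag_window k) = 2 * k\<^sup>2"
proof -
  have half: "u div 2 + (u + 1) div 2 = u" for u :: int by presburger
  have "inj_on (\<lambda>(u::int, c::int). ((u + 1) div 2 + c, u div 2 - c)) X" for X
  proof (rule inj_onI, clarsimp)
    fix u c u' c' :: int
    assume "(u + 1) div 2 + c = (u' + 1) div 2 + c'" "u div 2 - c = u' div 2 - c'"
    moreover from this have "u = u'" using half[of u] half[of u'] by linarith
    ultimately show "u = u' \<and> c = c'" by simp
  qed
  then show ?thesis
    by (simp add: diag_window_def card_image card_cartesian_product power2_eq_square nat_mult_distrib)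
qed

lemma diag_window_bounds:
  assumes "(i, j) \<in> diag_window k"
  shows "0 \<le> i + j" "i + j < 2 * int k" "0 \<le> i - j" "i - j < 2 * int k"
proof -
  obtain u c where uc: "0 \<le> u" "u < 2 * int k" "0 \<le> c" "c < int k"
    and ij: "i = (u + 1) div 2 + c" "j = u div 2 - c"
    using assms by (auto simp: diag_window_def)
  have "i + j = u" "i - j = 2 * c + u mod 2" unfolding ij by presburger+
  with uc show "0 \<le> i + j" "i + j < 2 * int k" "0 \<le> i - j" "i - j < 2 * int k" by presburger+
qed

text \<open>Once \<open>i + j\<close> is known, so is the parity of \<open>i - j\<close>, and
  halving \<open>i - j\<close> loses nothing. An interval of \<open>n\<close> integers has at most
  \<open>n / 2 + 1\<close> halves, whence the factor \<open>n + 2\<close>.\<close>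

lemma card_diag_box:
  fixes a b :: int and n :: nat
  defines "B \<equiv> {(i, j). a \<le> i + j \<and> i + j < a + int n \<and> b \<le> i - j \<and> i - j < b + int n}"
  shows "finite B" "2 * card B \<le> n * (n + 2)"
proof -
  define g :: "int \<times> int \<Rightarrow> int \<times> int" where "g = (\<lambda>(i, j). (i + j, (i - j) div 2))"
  define Y where "Y = {a..<a + int n} \<times> {b div 2..(b + int n - 1) div 2}"
  have inj: "inj_on g B"
  proof (rule inj_onI, clarsimp simp: g_def)
    fix i j i' j' :: int
    assume "i + j = i' + j'" "(i - j) div 2 = (i' - j') div 2"
    then show "i = i' \<and> j = j'" by presburger
  qed
  have sub: "g ` B \<subseteq> Y"
    by (auto simp: g_def B_def Y_def intro!: zdiv_mono1)
  have fin: "finite Y" by (simp add: Y_def)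
  show "finite B" using inj_on_finite[OF inj sub fin] .
  have "card B \<le> card Y" using card_inj_on_le[OF inj sub fin] .
  also have "card Y = n * nat ((b + int n - 1) div 2 - b div 2 + 1)"
    by (simp add: Y_def card_cartesian_product algebra_simps)
  finally have "2 * card B \<le> n * (2 * nat ((b + int n - 1) div 2 - b div 2 + 1))" by simp
  also have "\<dots> \<le> n * (n + 2)"
  proof (rule mult_left_mono)
    have "2 * ((b + int n - 1) div 2) \<le> b + int n - 1" "b \<le> 2 * (b div 2) + 1"
      by presburger+
    then show "2 * nat ((b + int n - 1) div 2 - b div 2 + 1) \<le> n + 2" by linarith
  qed simp
  finally show "2 * card B \<le> n * (n + 2)" .
qed

lemma square_DD_window_bound:
  assumes DD: "square_DD m r A"
  shows "4 * m\<^sup>2 * k\<^sup>2 \<le> (r + 2 * k) * (r + 2 * k + 2) * (m + 2 * k\<^sup>2)"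
proof (cases "A = {}")
  case True
  then show ?thesis using DD by (simp add: square_DD_def)
next
  case False
  have fin: "finite A" and m: "card A = m"
    and dist: "\<And>p q. p \<in> A \<Longrightarrow> q \<in> A \<Longrightarrow> manhattan_dist p q \<le> int r"
    and inj: "inj_on (\<lambda>(a, b). a - b) {(a, b). a \<in> A \<and> b \<in> A \<and> a \<noteq> b}"
    using DD by (auto simp: square_DD_def)
  define S where "S = (\<lambda>(i, j). i + j) ` A"
  define D where "D = (\<lambda>(i, j). i - j) ` A"
  have S: "finite S" "S \<noteq> {}" and D: "finite D" "D \<noteq> {}" using fin False by (auto simp: S_def D_def)
  obtain p where p: "p \<in> A" "Min S = fst p + snd p"
    using Min_in[OF S] by (auto simp: S_def)
  obtain q where q: "q \<in> A" "Min D = fst q - snd q"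
    using Min_in[OF D] by (auto simp: D_def)
  have lower: "Min S \<le> i + j" "Min D \<le> i - j" if "(i, j) \<in> A" for i j
    using that S D by (force simp: S_def D_def intro!: Min_le)+
  \<comment> \<open>Both |i + j| and |i - j| are at most |i| + |j|, so each diagonal coordinate
    varies by at most \<open>r\<close> over the dots.\<close>
  have upper: "i + j \<le> Min S + int r" "i - j \<le> Min D + int r" if "(i, j) \<in> A" for i j
    using dist[OF p(1) that] dist[OF q(1) that] p(2) q(2) by (auto simp: manhattan_dist_def)
  \<comment> \<open>Dots take \<open>r + 1\<close> possible values of a diagonal coordinate and
    window points \<open>2 * k\<close>; the differences fill an interval of \<open>r + 2 * k\<close>
    integers starting at \<open>a\<close> (respectively \<open>b\<close>).\<close>
  define n where "n = r + 2 * k"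
  define a where "a = Min S - 2 * int k + 1"
  define b where "b = Min D - 2 * int k + 1"
  define T where "T = {(i, j). a \<le> i + j \<and> i + j < a + int n \<and> b \<le> i - j \<and> i - j < b + int n}"
  have T: "finite T" "2 * card T \<le> n * (n + 2)"
    unfolding T_def by (rule card_diag_box)+
  have "x - w \<in> T" if "x \<in> A" "w \<in> diag_window k" for x w
  proof -
    obtain i j where x: "x = (i, j)" by force
    obtain i' j' where w: "w = (i', j')" by force
    show ?thesis
      using lower[of i j] upper[of i j] diag_window_bounds[of i' j' k] that
      by (simp add: x w T_def a_def b_def n_def)
  qed
  then have "(card A)\<^sup>2 * card (diag_window k) \<le> card T * (card A + card (diag_window k))"
    by (intro card_distinct_differences_window fin finite_diag_window T inj)
  then have "m\<^sup>2 * (2 * k\<^sup>2) \<le> card T * (m + 2 * k\<^sup>2)"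
    by (simp only: m card_diag_window)
  then have "4 * m\<^sup>2 * k\<^sup>2 \<le> 2 * card T * (m + 2 * k\<^sup>2)"
    by (simp add: algebra_simps)
  also have "\<dots> \<le> n * (n + 2) * (m + 2 * k\<^sup>2)" using T(2) by (rule mult_right_mono) simp
  finally show ?thesis by (simp add: n_def)
qed

section \<open>Solving the window inequality asymptotically\<close>

text \<open>
  Here \<open>x = r\<^bsup>1/3\<^esup>\<close> and \<open>c = 2\<^bsup>1/6\<^esup>\<close>. The bound on \<open>y\<close> is bootstrapped: the quadratic
  hypothesis gives \<open>y = O(x\<^sup>3)\<close>; its linearisation \<open>lin\<close> improves any bound fed into it.
\<close>

lemma window_bound_asymptotics:
  fixes c :: real
  assumes c: "c \<ge> 1" and c6: "c ^ 6 = 2"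
  obtains C where "\<And>x y s. x \<ge> 1 \<Longrightarrow> y \<ge> 0 \<Longrightarrow> c * x\<^sup>2 \<le> s \<Longrightarrow> s \<le> c * x\<^sup>2 + 2 \<Longrightarrow>
    y\<^sup>2 * s\<^sup>2 \<le> (x ^ 3 + s + 1)\<^sup>2 * (y + s\<^sup>2 / 2) \<Longrightarrow> y \<le> x ^ 3 / c ^ 3 + 3 / c ^ 8 * x\<^sup>2 + C * x"
proof
  \<comment> \<open>\<open>K\<close> bounds \<open>R / x ^ 3\<close>, \<open>C1\<close> bounds
    \<open>y / x ^ 3\<close>, \<open>C2\<close> is the coefficient of the \<open>x\<^sup>2\<close>
    error after one use of \<open>lin\<close>, and \<open>C\<close> sums the leftover terms after
    the second.\<close>
  define K where "K = c + 4"
  define C1 where "C1 = 2 * K\<^sup>2 + 1"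
  define C2 where "C2 = K + K * C1"
  define C where "C = 3 + C2 * (4 + c) + c + 3"
  have K: "K \<ge> 1" using c by (simp add: K_def)
  have C1: "C1 \<ge> 1" by (simp add: C1_def)
  have C2: "C2 \<ge> 0" using K C1 by (simp add: C2_def)
  fix x y s :: real
  assume x: "x \<ge> 1" and y: "y \<ge> 0" and s1: "c * x\<^sup>2 \<le> s" and s2: "s \<le> c * x\<^sup>2 + 2"
    and main: "y\<^sup>2 * s\<^sup>2 \<le> (x ^ 3 + s + 1)\<^sup>2 * (y + s\<^sup>2 / 2)"
  define R where "R = x ^ 3 + c * x\<^sup>2 + 3"
  have x23: "x\<^sup>2 \<le> x ^ 3" "1 \<le> x ^ 3" "1 \<le> x\<^sup>2" using x by (auto intro: power_increasing)
  have cp: "c ^ n \<ge> 1" "c ^ n > 0" for n using c one_le_power[OF c, of n] by auto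
  have div_c: "u / c ^ n \<le> u" if "u \<ge> 0" for u n
    using cp[of n] that by (simp add: divide_le_eq mult_le_cancel_left1)
  have s0: "s > 0" using s1 c x23 by (smt (verit) mult_le_cancel_left1 mult_mono)
  have R0: "R > 0" using x23 c unfolding R_def by (intro add_pos_pos mult_pos_pos) linarith+
  have RK: "R \<le> K * x ^ 3"
    using mult_left_mono[OF x23(1), of c] c x23 unfolding R_def K_def distrib_right by linarith
  have "y\<^sup>2 * s\<^sup>2 \<le> R\<^sup>2 * (y + s\<^sup>2 / 2)"
  proof (rule order_trans[OF main])
    show "(x ^ 3 + s + 1)\<^sup>2 * (y + s\<^sup>2 / 2) \<le> R\<^sup>2 * (y + s\<^sup>2 / 2)"
      using y s0 s2 x23 by (intro mult_right_mono power_mono) (auto simp: R_def)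
  qed
  then have "y\<^sup>2 \<le> R\<^sup>2 * (y / s\<^sup>2 + 1 / 2)"
    using s0 by (simp add: field_simps)
  also have "\<dots> \<le> R\<^sup>2 * (y / (c * x\<^sup>2)\<^sup>2 + 1 / 2)"
    using s1 y c x s0
    by (intro mult_left_mono add_right_mono divide_left_mono power_mono mult_pos_pos zero_less_power) auto
  finally have quad: "y\<^sup>2 \<le> R\<^sup>2 * (y / (c\<^sup>2 * x ^ 4) + 1 / 2)"
    by (simp add: power_mult_distrib flip: power_mult)
  define z where "z = y / (c\<^sup>2 * x ^ 4)"
  have z0: "z \<ge> 0" using y by (simp add: z_def)
  \<comment> \<open>As \<open>c ^ 6 = 2\<close>, the summand \<open>1 / 2\<close> is
    \<open>1 / c ^ 6\<close>; then 1 + 2z \<le> (1 + z)^2 allows taking the square root.\<close>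
  have "y\<^sup>2 \<le> (R / c ^ 3)\<^sup>2 * (1 + 2 * z)"
    using quad c6 by (simp add: z_def power_divide field_simps flip: power_mult)
  also have "\<dots> \<le> (R / c ^ 3)\<^sup>2 * (1 + z)\<^sup>2"
    using z0 by (intro mult_left_mono) (auto simp: power2_eq_square algebra_simps)
  finally have "y\<^sup>2 \<le> (R / c ^ 3 * (1 + z))\<^sup>2" by (simp only: power_mult_distrib)
  then have lin0: "y \<le> R / c ^ 3 * (1 + z)"
    by (rule power2_le_imp_le) (use R0 z0 c in simp)
  \<comment> \<open>The coefficient of \<open>b\<close> is O(1/x), so each use shrinks the error by
    a factor of order \<open>x\<close>.\<close>
  have lin: "y \<le> R / c ^ 3 + R / (c ^ 5 * x ^ 4) * b" if "y \<le> b" for b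
  proof -
    have "y \<le> R / c ^ 3 + R / (c ^ 5 * x ^ 4) * y"
      using lin0 by (simp add: z_def add_divide_distrib distrib_left mult_ac flip: power_add)
    also have "\<dots> \<le> R / c ^ 3 + R / (c ^ 5 * x ^ 4) * b"
      using that R0 c x by (intro add_left_mono mult_left_mono) auto
    finally show ?thesis .
  qed
  \<comment> \<open>For small \<open>x\<close> the coefficient in \<open>lin\<close> can exceed 1,
    so the starting bound comes from \<open>quad\<close>: once \<open>y > x ^ 3\<close>, its right
    side is at most \<open>2 * K\<^sup>2 * x ^ 3 * y\<close>, and \<open>y\<close> cancels.\<close>
  have "y \<le> C1 * x ^ 3"
  proof (rule ccontr)
    assume "\<not> y \<le> C1 * x ^ 3"
    then have big: "y > C1 * x ^ 3" by simp
    then have yx: "y > x ^ 3" using C1 x23 by (smt (verit) mult_right_mono mult_cancel_right1)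
    have "R\<^sup>2 * (z + 1 / 2) \<le> (K * x ^ 3)\<^sup>2 * (z + 1 / 2)"
      using RK R0 z0 by (intro mult_right_mono power_mono) auto
    with quad have "y\<^sup>2 \<le> (K * x ^ 3)\<^sup>2 * (y / (c\<^sup>2 * x ^ 4) + 1 / 2)"
      by (simp only: z_def)
    also have "\<dots> = K\<^sup>2 * (x\<^sup>2 / c\<^sup>2 * y + x ^ 3 * x ^ 3 / 2)"
      using x c by (simp add: field_simps eval_nat_numeral)
    also have "\<dots> \<le> K\<^sup>2 * (x\<^sup>2 * y + x ^ 3 * y)"
    proof (intro mult_left_mono add_mono mult_right_mono)
      show "x\<^sup>2 / c\<^sup>2 \<le> x\<^sup>2" using cp(1)[of 2] x by (simp add: divide_le_eq mult_le_cancel_left1)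
      have "x ^ 3 * x ^ 3 \<le> x ^ 3 * y" using yx x by (intro mult_left_mono) auto
      then show "x ^ 3 * x ^ 3 / 2 \<le> x ^ 3 * y" using x23 y mult_nonneg_nonneg[of "x ^ 3" y] by linarith
    qed (use y in auto)
    also have "\<dots> \<le> K\<^sup>2 * (x ^ 3 * y + x ^ 3 * y)"
      using x23 y by (intro mult_left_mono add_mono mult_right_mono) auto
    finally have "y * y \<le> 2 * K\<^sup>2 * x ^ 3 * y"
      by (simp add: power2_eq_square mult_ac)
    then have "y \<le> 2 * K\<^sup>2 * x ^ 3" using yx x23 by simp
    then show False using big x23 by (simp add: C1_def algebra_simps)
  qed
  then have "y \<le> R / c ^ 3 + R / (c ^ 5 * x ^ 4) * (C1 * x ^ 3)" by (rule lin)
  also have "\<dots> \<le> x ^ 3 / c ^ 3 + C2 * x\<^sup>2"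
  proof -
    have "(c * x\<^sup>2 + 3) / c ^ 3 \<le> c * x\<^sup>2 + 3"
      using c by (intro div_c) simp
    also have "\<dots> \<le> K * x\<^sup>2" using x23 by (simp add: K_def algebra_simps)
    finally have 1: "R / c ^ 3 \<le> x ^ 3 / c ^ 3 + K * x\<^sup>2"
      by (simp add: R_def add_divide_distrib)
    have "R / (c ^ 5 * x ^ 4) * (C1 * x ^ 3) \<le> (K * x ^ 3) / (1 * x ^ 4) * (C1 * x ^ 3)"
      using RK R0 cp[of 5] x C1 K by (intro mult_right_mono frac_le) auto
    also have "\<dots> = K * C1 * x\<^sup>2" using x by (simp add: field_simps eval_nat_numeral)
    finally show ?thesis using 1 by (simp add: C2_def algebra_simps)
  qed
  finally have "y \<le> R / c ^ 3 + R / (c ^ 5 * x ^ 4) * (x ^ 3 / c ^ 3 + C2 * x\<^sup>2)" by (rule lin)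
  also have "\<dots> \<le> x ^ 3 / c ^ 3 + 3 / c ^ 8 * x\<^sup>2 + C * x"
  proof -
    have div_cx: "u / (c ^ n * x ^ l) \<le> u * x" if "u \<ge> 0" for u n l
    proof -
      have "1 \<le> c ^ n * x ^ l"
        using cp[of n] x one_le_power[OF x, of l] mult_mono[of 1 "c ^ n" 1 "x ^ l"] by simp
      then have "u / (c ^ n * x ^ l) \<le> u / 1" using that by (intro divide_left_mono) auto
      also have "\<dots> \<le> u * x" using that x by (simp add: mult_le_cancel_left1)
      finally show ?thesis .
    qed
    \<comment> \<open>The \<open>x\<^sup>2\<close> terms are c/c^3 = c^6/c^8, from the window side
      in \<open>R\<close>, and 1/c^8, from feeding the main term back. All terms after them are
      O(x).\<close>
    have "R / c ^ 3 + R / (c ^ 5 * x ^ 4) * (x ^ 3 / c ^ 3 + C2 * x\<^sup>2) =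
        x ^ 3 / c ^ 3 + x\<^sup>2 * (c ^ 6 / c ^ 8 + 1 / c ^ 8) + 3 / c ^ 3 + c * x / c ^ 8 + 3 / (c ^ 8 * x)
        + C2 * x / c ^ 5 + c * C2 / c ^ 5 + 3 * C2 / (c ^ 5 * x\<^sup>2)"
      using x c by (simp add: R_def field_simps eval_nat_numeral)
    also have "c ^ 6 / c ^ 8 + 1 / c ^ 8 = 3 / c ^ 8"
      by (simp add: c6 flip: add_divide_distrib)
    finally show ?thesis
      using div_cx[of 3 3 0] div_cx[of 3 8 1] div_cx[of "c * C2" 5 0] div_cx[of "3 * C2" 5 2]
        div_c[of "c * x" 8] div_c[of "C2 * x" 5] c C2 x
      by (simp add: C_def algebra_simps)
  qed
  finally show "y \<le> x ^ 3 / c ^ 3 + 3 / c ^ 8 * x\<^sup>2 + C * x" .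
qed

section \<open>Choice of the window side\<close>

theorem theorem6:
  shows "\<exists>C::real. \<forall>r m :: nat. r > 0 \<longrightarrow> (\<exists>A. square_DD m r A) \<longrightarrow>
    real m \<le> 1 / sqrt 2 * real r + 3 / 2 powr (4/3) * real r powr (2/3) + C * real r powr (1/3)"
proof -
  \<comment> \<open>To second order \<open>m\<close> is at most (r + s)/sqrt 2 + r^2/(2 s^2), which
    is least at s^3 = sqrt 2 * r^2, that is, at \<open>s = c * x\<^sup>2\<close>.\<close>
  define c :: real where "c = 2 powr (1/6)"
  have c: "c \<ge> 1" by (simp add: c_def ge_one_powr_ge_zero)
  have c_pow: "c ^ n = 2 powr (real n / 6)" for n
    by (simp add: c_def powr_powr flip: powr_realpow)
  have c6: "c ^ 6 = 2" and c3: "c ^ 3 = sqrt 2" and c8: "c ^ 8 = 2 powr (4/3)"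
    by (simp_all add: c_pow powr_half_sqrt)
  obtain C where C: "\<And>x y s. x \<ge> 1 \<Longrightarrow> y \<ge> 0 \<Longrightarrow> c * x\<^sup>2 \<le> s \<Longrightarrow> s \<le> c * x\<^sup>2 + 2 \<Longrightarrow>
    y\<^sup>2 * s\<^sup>2 \<le> (x ^ 3 + s + 1)\<^sup>2 * (y + s\<^sup>2 / 2) \<Longrightarrow> y \<le> x ^ 3 / c ^ 3 + 3 / c ^ 8 * x\<^sup>2 + C * x"
    using window_bound_asymptotics[OF c c6] by blast
  show ?thesis
  proof (intro exI[of _ C] allI impI, elim exE)
    fix r m :: nat and A
    assume r: "r > 0" and DD: "square_DD m r A"
    define x where "x = real r powr (1/3)"
    have x_pow: "x ^ n = real r powr (real n / 3)" for n
      using r by (simp add: x_def powr_powr flip: powr_realpow)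
    have x: "x \<ge> 1" and x3: "x ^ 3 = real r" and x2: "x\<^sup>2 = real r powr (2/3)"
      using r x_pow[of 2] x_pow[of 3] by (simp_all add: x_def ge_one_powr_ge_zero)
    define k where "k = nat \<lceil>c * x\<^sup>2 / 2\<rceil>"
    define s where "s = 2 * real k"
    have "c * x\<^sup>2 / 2 \<ge> 0" using c by simp
    then have s: "c * x\<^sup>2 \<le> s" "s \<le> c * x\<^sup>2 + 2" unfolding s_def k_def by linarith+
    have "real (4 * m\<^sup>2 * k\<^sup>2) \<le> real ((r + 2 * k) * (r + 2 * k + 2) * (m + 2 * k\<^sup>2))"
      using square_DD_window_bound[OF DD] by (simp only: of_nat_le_iff)
    then have "(real m)\<^sup>2 * s\<^sup>2 \<le> (x ^ 3 + s) * (x ^ 3 + s + 2) * (real m + s\<^sup>2 / 2)"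
      by (simp add: s_def x3 power_mult_distrib algebra_simps)
    \<comment> \<open>X(X + 2) \<le> (X + 1)^2 absorbs the parity loss in the box count.\<close>
    also have "\<dots> \<le> (x ^ 3 + s + 1)\<^sup>2 * (real m + s\<^sup>2 / 2)"
      by (rule mult_right_mono) (simp_all add: power2_eq_square algebra_simps)
    finally have "real m \<le> x ^ 3 / c ^ 3 + 3 / c ^ 8 * x\<^sup>2 + C * x"
      by (intro C[of x "real m" s] x s) simp_all
    then show "real m \<le> 1 / sqrt 2 * real r + 3 / 2 powr (4/3) * real r powr (2/3) + C * real r powr (1/3)"
      by (simp add: c3 c8 x3 x2 flip: x_def)
  qed
qed

end
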